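(* Let $d\ge1$ and, for $k=1,2$, let $\Sigma_k$ be a $d\times d$ covariance matrix, $U^{(k)}\sim\mathcal N_d(0,\Sigma_k)$, $\sigma_{k,i}^2:=(\Sigma_k)_{ii}$, and $$Z_i^{(k)}:=\exp\bigl(U_i^{(k)}-\tfrac12\sigma_{k,i}^2\bigr),\qquad i=1,\dots,d.$$ Let $F_k=e^{-V_k}$ be the Brown--Resnick distribution function with exponent function $V_k(x)=\mathbb{E}\{\max_{1\le i\le d}Z_i^{(k)}/x_i\}$, $x\in(0,\infty)^d$. Put $a_k:=\frac12(\sigma_{k,1}^2,\dots,\sigma_{k,d}^2)$ and $$L(\Sigma_1,\Sigma_2):=\left[\sum_{i=1}^d\left(e^{\sigma_{1,i}^2/2}+e^{\sigma_{2,i}^2/2}\right)^2\right]^{1/2}.$$ Then $$\mathrm d_K(F_1,F_2)\le\omega\Bigl(L(\Sigma_1,\Sigma_2)\,W_2\bigl(\mathcal N_d(-a_1,\Sigma_1),\mathcal N_d(-a_2,\Sigma_2)\bigr)\Bigr),$$ and in particular $$\mathrm d_K(F_1,F_2)\le\frac{L(\Sigma_1,\Sigma_2)}{e}\,W_2\bigl(\mathcal N_d(-a_1,\Sigma_1),\mathcal N_d(-a_2,\Sigma_2)\bigr).$$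
   Context: $F_k(x)=e^{-V_k(x)}$ for $x\in(0,\infty)^d$ and $F_k(x)=0$ if some coordinate of $x$ is non-positive. Kolmogorov distance: $\mathrm d_K(F_1,F_2)=\sup_{x\in\mathbb{R}^d}|F_1(x)-F_2(x)|$. The function $\omega:[0,\infty)\to[0,\infty)$ is $\omega(0)=0$ and $\omega(t)=\frac{t}{1+t}(1+t)^{-1/t}$ for $t>0$. $W_2$ is the quadratic Wasserstein distance with Euclidean cost: $W_2(\mu,\nu)=\inf_\pi(\int\|x-y\|_2^2\,\pi(dx,dy))^{1/2}$ over all couplings $\pi$ of $\mu$ and $\nu$. Covariance matrices may be singular. *)

theory Defs
  imports "HOL-Probability.Probability"
begin

definition covariance_matrix :: "real ^ 'd ^ 'd \<Rightarrow> bool" where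
  "covariance_matrix S \<longleftrightarrow> transpose S = S \<and> (\<forall>v. 0 \<le> v \<bullet> (S *v v))"

text \<open>
  Every covariance matrix, singular or not, factors as \<open>A ** transpose A\<close>; the proof is a
  Cholesky elimination on a set \<open>I\<close> containing the support of \<open>S\<close>.
\<close>

lemma covariance_factor_aux:
  fixes S :: "real ^ 'd ^ 'd"
  assumes "finite I" and "covariance_matrix S"
    and "\<And>i j. i \<notin> I \<Longrightarrow> S $ i $ j = 0"
  shows "\<exists>A :: real ^ 'd ^ 'd. A ** transpose A = S \<and> (\<forall>i j. j \<notin> I \<longrightarrow> A $ i $ j = 0)"
  using assms
proof (induction I arbitrary: S rule: finite_induct)
  case empty
  then have "S = 0" by (simp add: vec_eq_iff)
  then show ?case by (intro exI[of _ 0]) (simp add: matrix_matrix_mult_def vec_eq_iff)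
next
  case (insert k I)
  have sym: "S $ i $ j = S $ j $ i" for i j
  proof -
    have "transpose S $ j $ i = S $ j $ i"
      using insert.prems(1) by (simp only: covariance_matrix_def)
    then show ?thesis by (simp only: transpose_def vec_lambda_beta)
  qed
  have psd: "0 \<le> v \<bullet> (S *v v)" for v
    using insert.prems(1) by (simp add: covariance_matrix_def)
  have quad: "v \<bullet> (S *v v) = (\<Sum>i\<in>UNIV. \<Sum>j\<in>UNIV. v $ i * S $ i $ j * v $ j)"
    for S :: "real ^ 'd ^ 'd" and v
    by (simp add: inner_vec_def matrix_vector_mult_def sum_distrib_left mult.assoc)
  define s where "s = S *v axis k 1"
  have s: "s $ i = S $ i $ k" for i
    by (simp add: s_def matrix_vector_mult_basis column_def)
  define c where "c = S $ k $ k"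
  have ev: "(v + t *\<^sub>R axis k 1) \<bullet> (S *v (v + t *\<^sub>R axis k 1))
      = v \<bullet> (S *v v) + 2 * t * (s \<bullet> v) + t^2 * c" for v t
  proof -
    have 1: "axis k 1 \<bullet> (S *v v) = s \<bullet> v"
    proof -
      have "axis k 1 \<bullet> (S *v v) = (S *v v) $ k" by (simp add: inner_axis')
      also have "\<dots> = (\<Sum>j\<in>UNIV. S $ j $ k * v $ j)"
        by (simp add: matrix_vector_mult_def sym[of k])
      also have "\<dots> = s \<bullet> v" by (simp add: inner_vec_def s)
      finally show ?thesis .
    qed
    have 2: "axis k 1 \<bullet> s = c" by (simp add: inner_axis' s c_def)
    have "S *v (v + t *\<^sub>R axis k 1) = S *v v + t *\<^sub>R s"
      by (simp add: s_def matrix_vector_right_distrib matrix_vector_mult_scaleR)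
    then show ?thesis
      by (simp add: inner_add_left inner_add_right 1 2 inner_commute[of v s] power2_eq_square
          distrib_left)
  qed
  have c0: "0 \<le> c"
    using psd[of "axis k 1"] unfolding s_def[symmetric] by (simp add: inner_axis' s c_def)
  define S' where "S' = (\<chi> i j. S $ i $ j - s $ i * s $ j / c)"
  have S'q: "v \<bullet> (S' *v v) = v \<bullet> (S *v v) - (s \<bullet> v)^2 / c" for v
  proof -
    have "(s \<bullet> v)^2 / c = (\<Sum>i\<in>UNIV. \<Sum>j\<in>UNIV. v $ i * (s $ i * s $ j / c) * v $ j)"
      by (simp add: inner_vec_def power2_eq_square sum_product sum_divide_distrib mult_ac)
    then show ?thesis
      unfolding quad by (simp add: S'_def left_diff_distrib right_diff_distrib sum_subtractf)
  qed
  have "covariance_matrix S'"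
    unfolding covariance_matrix_def
  proof (intro conjI allI)
    show "transpose S' = S'"
      by (simp add: S'_def transpose_def vec_eq_iff mult.commute sym)
    fix v
    show "0 \<le> v \<bullet> (S' *v v)"
    proof (cases "c = 0")
      case True then show ?thesis using psd by (simp add: S'q)
    next
      case False
      have "0 \<le> v \<bullet> (S *v v) + 2 * (- (s \<bullet> v) / c) * (s \<bullet> v) + (- (s \<bullet> v) / c)^2 * c"
        using psd[of "v + (- (s \<bullet> v) / c) *\<^sub>R axis k 1"] unfolding ev .
      also have "\<dots> = v \<bullet> (S' *v v)"
        using False by (simp add: S'q power2_eq_square field_simps)
      finally show ?thesis .
    qed
  qed
  have s0: "s = 0" if "c = 0"
  proof (rule ccontr)
    assume "s \<noteq> 0"
    then have p: "0 < s \<bullet> s" by simp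
    define t where "t = - (s \<bullet> (S *v s) + 1) / (2 * (s \<bullet> s))"
    have "0 \<le> s \<bullet> (S *v s) + 2 * t * (s \<bullet> s) + t^2 * c"
      using psd[of "s + t *\<^sub>R axis k 1"] unfolding ev .
    also have "\<dots> = -1" using p that by (simp add: t_def field_simps)
    finally show False by simp
  qed
  have "S' $ i $ j = 0" if "i \<notin> I" for i j
  proof (cases "i = k")
    case True
    then show ?thesis
    proof (cases "c = 0")
      case c: True
      have "s $ j = 0" using s0[OF c] by simp
      then show ?thesis using True sym[of k j] by (simp add: S'_def s[of j] c)
    next
      case False
      have "s $ k = c" "S $ k $ j = s $ j" using sym[of k j] by (simp_all add: s c_def)
      then show ?thesis using True False by (simp add: S'_def)
    qed
  next
    case False
    then show ?thesis using that insert.prems(2)[of i] by (simp add: S'_def s)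
  qed
  then obtain A where A: "A ** transpose A = S'" and A0: "\<And>i j. j \<notin> I \<Longrightarrow> A $ i $ j = 0"
    using insert.IH[OF \<open>covariance_matrix S'\<close>] by blast
  define B where "B = (\<chi> i j. if j = k then s $ i / sqrt c else A $ i $ j)"
  have "(B ** transpose B) $ i $ j = S $ i $ j" for i j
  proof -
    have Ak: "A $ i $ k = 0" for i using A0 insert.hyps by blast
    have "(B ** transpose B) $ i $ j = (\<Sum>l\<in>UNIV. B $ i $ l * B $ j $ l)"
      by (simp add: matrix_matrix_mult_def transpose_def)
    also have "\<dots> = (\<Sum>l\<in>UNIV. A $ i $ l * A $ j $ l + (if l = k then s $ i * s $ j / c else 0))"
      using c0 by (intro sum.cong) (auto simp: B_def Ak)
    also have "\<dots> = (A ** transpose A) $ i $ j + s $ i * s $ j / c"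
      by (simp add: sum.distrib matrix_matrix_mult_def transpose_def)
    also have "\<dots> = S $ i $ j" unfolding A by (simp add: S'_def)
    finally show ?thesis .
  qed
  moreover have "B $ i $ j = 0" if "j \<notin> insert k I" for i j
    using that A0 by (simp add: B_def)
  ultimately show ?case by (intro exI[of _ B]) (simp add: vec_eq_iff)
qed

lemma covariance_factor:
  fixes S :: "real ^ 'd ^ 'd"
  assumes "covariance_matrix S"
  shows "\<exists>A :: real ^ 'd ^ 'd. A ** transpose A = S"
proof -
  have "\<exists>A :: real ^ 'd ^ 'd. A ** transpose A = S \<and> (\<forall>i j. j \<notin> UNIV \<longrightarrow> A $ i $ j = 0)"
    by (rule covariance_factor_aux[OF finite assms]) simp
  then show ?thesis by blast
qed

definition covariance_root :: "real ^ 'd ^ 'd \<Rightarrow> real ^ 'd ^ 'd" where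
  "covariance_root S = (SOME A. A ** transpose A = S)"

lemma covariance_root:
  "covariance_matrix S \<Longrightarrow> covariance_root S ** transpose (covariance_root S) = S"
  unfolding covariance_root_def by (rule someI_ex) (rule covariance_factor)

definition std_normal_vec :: "(real ^ 'd) measure" where
  "std_normal_vec = density lborel (\<lambda>x. ennreal (\<Prod>i\<in>UNIV. std_normal_density (x $ i)))"

text \<open>
  \<open>multivariate_normal m S\<close> is the law of \<open>m + A *v X\<close> with \<open>X\<close> standard normal and
  \<open>A ** transpose A = S\<close>. The law does not depend on the choice of \<open>A\<close>, and \<open>S\<close> may be singular.
\<close>

definition multivariate_normal :: "real ^ 'd \<Rightarrow> real ^ 'd ^ 'd \<Rightarrow> (real ^ 'd) measure" where
  "multivariate_normal m S = distr std_normal_vec borel (\<lambda>x. m + covariance_root S *v x)"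

definition couplings :: "'a measure \<Rightarrow> 'b measure \<Rightarrow> ('a \<times> 'b) measure set" where
  "couplings M N =
     {P. sets P = sets (M \<Otimes>\<^sub>M N) \<and> distr P M fst = M \<and> distr P N snd = N}"

text \<open>
  Couplings of infinite cost are left out of the infimum, as they cannot affect it when some
  coupling has finite cost; this is always the case for two laws with finite second moments.
\<close>

definition wasserstein2 :: "'a::euclidean_space measure \<Rightarrow> 'a measure \<Rightarrow> real" where
  "wasserstein2 M N =
     (INF P \<in> {P \<in> couplings M N. integrable P (\<lambda>(x, y). (norm (x - y))\<^sup>2)}.
        sqrt (\<integral>(x, y). (norm (x - y))\<^sup>2 \<partial>P))"

definition kolmogorov_dist :: "('a \<Rightarrow> real) \<Rightarrow> ('a \<Rightarrow> real) \<Rightarrow> real" where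
  "kolmogorov_dist F G = (SUP x. \<bar>F x - G x\<bar>)"

definition half_variances :: "real ^ 'd ^ 'd \<Rightarrow> real ^ 'd" where
  "half_variances S = (\<chi> i. S $ i $ i / 2)"

definition br_spectral :: "real ^ 'd ^ 'd \<Rightarrow> real ^ 'd \<Rightarrow> real ^ 'd" where
  "br_spectral S u = (\<chi> i. exp (u $ i - S $ i $ i / 2))"

definition exponent_function :: "'w measure \<Rightarrow> ('w \<Rightarrow> real ^ 'd) \<Rightarrow> real ^ 'd \<Rightarrow> real" where
  "exponent_function M Z x = (\<integral>w. (MAX i. Z w $ i / x $ i) \<partial>M)"

definition max_stable_cdf :: "(real ^ 'd \<Rightarrow> real) \<Rightarrow> real ^ 'd \<Rightarrow> real" where
  "max_stable_cdf V x = (if \<forall>i. 0 < x $ i then exp (- V x) else 0)"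

definition omega :: "real \<Rightarrow> real" where
  "omega t = (if t = 0 then 0 else t / (1 + t) * (1 + t) powr (- 1 / t))"

definition br_const :: "real ^ 'd ^ 'd \<Rightarrow> real ^ 'd ^ 'd \<Rightarrow> real" where
  "br_const S T = sqrt (\<Sum>i\<in>UNIV. (exp (S $ i $ i / 2) + exp (T $ i $ i / 2))\<^sup>2)"

end

theory Submission
  imports Defs
begin

text \<open>
  Write \<open>V\<^sub>k x = E (max\<^sub>i exp (Y\<^sub>k\<^sub>i) / x\<^sub>i)\<close> with \<open>Y\<^sub>k\<close> distributed as \<open>N(-a\<^sub>k, \<Sigma>\<^sub>k)\<close>. Only the law of
  \<open>Y\<^sub>k\<close> matters, so both exponent functions can be computed on one coupling \<open>P\<close> of the two normal
  laws. Let \<open>m = max\<^sub>i 1 / x\<^sub>i\<close>. Since \<open>\<bar>exp u - exp v\<bar> \<le> max (exp u) (exp v) * \<bar>u - v\<bar>\<close>, the integrands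
  differ by at most \<open>m\<close> times the product of the norm of the vector with entries
  \<open>max (exp u\<^sub>i) (exp v\<^sub>i)\<close> and the norm of \<open>u - v\<close>
  (\<open>abs_br_max_diff_le\<close>). The Cauchy-Schwarz inequality and \<open>E exp (2 Y\<^sub>k\<^sub>i) = exp (\<sigma>\<^sub>k\<^sub>i\<^sup>2)\<close> bound the
  expectation of this product by \<open>L * sqrt (E \<bar>Y\<^sub>1 - Y\<^sub>2\<bar>\<^sup>2)\<close>
  (\<open>integral_br_max_diff_le_coupling\<close>), and the infimum over all couplings gives
  \<open>\<bar>V\<^sub>1 x - V\<^sub>2 x\<bar> \<le> t * m\<close> with \<open>t = L * W\<^sub>2\<close>.

  Since \<open>E exp (Y\<^sub>k\<^sub>i) = 1\<close>, also \<open>m \<le> V\<^sub>k x\<close> (\<open>inverse_le_integral_br_max\<close>). Hence each of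
  \<open>V\<^sub>1 x\<close> and \<open>V\<^sub>2 x\<close> is at most \<open>1 + t\<close> times the other one. Now \<open>omega t\<close> is the maximum over \<open>s\<close> of
  \<open>exp (- s) - exp (- (1 + t) * s)\<close>, which gives the first bound (\<open>exp_diff_le_omega\<close>). The second
  one follows from \<open>omega t \<le> t / e\<close>.
\<close>

section \<open>Exponential moments of the multivariate normal law\<close>

lemma std_normal_vec_exp:
  fixes v :: "real ^ 'd"
  shows "has_bochner_integral std_normal_vec (\<lambda>x. exp (v \<bullet> x)) (exp (v \<bullet> v / 2))"
proof (rule has_bochner_integral_nn_integral)
  show "(\<lambda>x. exp (v \<bullet> x)) \<in> borel_measurable std_normal_vec"
    by (simp add: std_normal_vec_def)
  have shift: "(\<integral>\<^sup>+t. ennreal (exp (c * t) * std_normal_density t) \<partial>lborel) = ennreal (exp (c\<^sup>2 / 2))"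
    for c
  proof -
    \<comment> \<open>Completing the square turns the integrand into a shifted normal density.\<close>
    have "exp (c * t) * std_normal_density t = exp (c\<^sup>2 / 2) * normal_density c 1 t" for t
    proof -
      have "c * t + - t\<^sup>2 / 2 = c\<^sup>2 / 2 + - (t - c)\<^sup>2 / 2"
        by (simp add: power2_eq_square field_simps)
      then have "exp (c * t) * exp (- t\<^sup>2 / 2) = exp (c\<^sup>2 / 2) * exp (- (t - c)\<^sup>2 / 2)"
        by (simp only: exp_add [symmetric])
      then show ?thesis by (simp add: normal_density_def)
    qed
    moreover have "(\<integral>\<^sup>+t. ennreal (normal_density c 1 t) \<partial>lborel) = 1"
      by (simp add: nn_integral_eq_integral normal_density_nonneg)
    ultimately show ?thesis
      by (simp add: ennreal_mult nn_integral_cmult normal_density_nonneg)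
  qed
  define f :: "real ^ 'd \<Rightarrow> real \<Rightarrow> ennreal"
    where "f b t = ennreal (exp ((v \<bullet> b) * t) * std_normal_density t)" for b t
  have reindex: "(\<Prod>b\<in>Basis. h b) = (\<Prod>i\<in>UNIV. h (axis i 1))"
    for h :: "real ^ 'd \<Rightarrow> ennreal"
  proof -
    have "bij_betw (\<lambda>i. axis i 1) UNIV (Basis :: (real ^ 'd) set)"
      by (auto simp: bij_betw_def inj_on_def axis_eq_axis Basis_vec_def)
    from prod.reindex_bij_betw[OF this, of h] show ?thesis by simp
  qed
  have pointwise: "ennreal (\<Prod>i\<in>UNIV. std_normal_density (x $ i)) * ennreal (exp (v \<bullet> x))
      = (\<Prod>b\<in>Basis. f b (x \<bullet> b))" for x
  proof -
    have "exp (v \<bullet> x) = (\<Prod>i\<in>UNIV. exp (v $ i * x $ i))"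
      by (simp add: inner_vec_def exp_sum)
    then have "(\<Prod>i\<in>UNIV. std_normal_density (x $ i)) * exp (v \<bullet> x)
        = (\<Prod>i\<in>UNIV. exp (v $ i * x $ i) * std_normal_density (x $ i))"
      by (simp add: prod.distrib mult.commute)
    then show ?thesis
      by (simp add: reindex f_def inner_axis prod_ennreal ennreal_mult[symmetric] prod_nonneg
          normal_density_nonneg)
  qed
  have "(\<integral>\<^sup>+x. ennreal (exp (v \<bullet> x)) \<partial>std_normal_vec) = (\<integral>\<^sup>+x. (\<Prod>b\<in>Basis. f b (x \<bullet> b)) \<partial>lborel)"
    unfolding std_normal_vec_def by (subst nn_integral_density) (simp_all add: pointwise)
  also have "\<dots> = (\<Prod>b\<in>Basis. \<integral>\<^sup>+t. f b t \<partial>lborel)"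
    by (rule nn_integral_lborel_prod) (simp_all add: f_def)
  also have "\<dots> = (\<Prod>i\<in>UNIV. ennreal (exp ((v $ i)\<^sup>2 / 2)))"
    by (simp add: reindex f_def inner_axis shift)
  also have "\<dots> = ennreal (exp (v \<bullet> v / 2))"
    by (simp add: prod_ennreal exp_sum[symmetric] inner_vec_def power2_eq_square
        sum_divide_distrib)
  finally show "(\<integral>\<^sup>+x. ennreal (exp (v \<bullet> x)) \<partial>std_normal_vec) = ennreal (exp (v \<bullet> v / 2))" .
qed simp_all

lemma borel_measurable_matrix_vector_mult [measurable]:
  fixes A :: "real ^ 'd ^ 'e"
  shows "(\<lambda>x. A *v x) \<in> borel_measurable borel"
  by (intro borel_measurable_continuous_onI linear_continuous_on)
    (simp add: linear_linear[symmetric] matrix_vector_mul_linear)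

lemma sets_std_normal_vec [simp, measurable_cong]: "sets std_normal_vec = sets borel"
  by (simp add: std_normal_vec_def)

lemma sets_multivariate_normal [simp, measurable_cong]:
  "sets (multivariate_normal m S) = sets borel"
  by (simp add: multivariate_normal_def)

text \<open>
  The moment generating function does not depend on the chosen root of \<open>S\<close>. The values used below
  are those at multiples of the unit vectors.
\<close>

lemma multivariate_normal_exp:
  fixes v m :: "real ^ 'd"
  assumes "covariance_matrix S"
  shows "has_bochner_integral (multivariate_normal m S) (\<lambda>y. exp (v \<bullet> y))
    (exp (v \<bullet> m + v \<bullet> (S *v v) / 2))"
proof -
  define A where "A = covariance_root S"
  have A: "A ** transpose A = S"
    unfolding A_def by (rule covariance_root[OF assms])
  have inner: "v \<bullet> (A *v x) = (v v* A) \<bullet> x" for x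
    by (simp add: dot_lmul_matrix)
  have "(v v* A) \<bullet> (v v* A) = v \<bullet> (S *v v)"
    by (simp add: dot_lmul_matrix A[symmetric] matrix_vector_mul_assoc[symmetric])
  then have "has_bochner_integral std_normal_vec (\<lambda>x. exp (v \<bullet> m) * exp (v \<bullet> (A *v x)))
      (exp (v \<bullet> m) * exp (v \<bullet> (S *v v) / 2))"
    unfolding inner using std_normal_vec_exp[of "v v* A"]
    by (intro has_bochner_integral_mult_right) simp_all
  then show ?thesis
    unfolding multivariate_normal_def A_def[symmetric]
    by (intro has_bochner_integral_distr)
       (simp_all add: exp_add inner_add_right)
qed

lemma multivariate_normal_exp_component:
  fixes S :: "real ^ 'd ^ 'd"
  assumes "covariance_matrix S"
  shows "has_bochner_integral (multivariate_normal m S) (\<lambda>y. exp (c * y $ i))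
    (exp (c * m $ i + c\<^sup>2 * S $ i $ i / 2))"
proof -
  have "axis i 1 \<bullet> y = y $ i" for y :: "real ^ 'd"
    by (simp add: inner_axis')
  moreover have "(S *v (c *\<^sub>R axis i 1)) $ i = c * S $ i $ i"
    by (simp add: matrix_vector_mult_scaleR matrix_vector_mult_basis column_def)
  ultimately show ?thesis
    using multivariate_normal_exp[OF assms, of m "c *\<^sub>R axis i 1"]
    by (simp add: power2_eq_square mult.assoc)
qed

lemma multivariate_normal_shift:
  "multivariate_normal m S = distr (multivariate_normal 0 S) borel (\<lambda>y. m + y)"
  unfolding multivariate_normal_def by (simp add: distr_distr comp_def)

lemma integrable_norm_square_multivariate_normal:
  fixes m :: "real ^ 'd"
  assumes "covariance_matrix S"
  shows "integrable (multivariate_normal m S) (\<lambda>y. (norm y)\<^sup>2)"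
proof -
  have sq: "t\<^sup>2 \<le> 2 * (exp t + exp (- t))" for t :: real
  proof -
    have *: "s\<^sup>2 \<le> 2 * (exp s + exp (- s))" if "0 \<le> s" for s :: real
      using exp_lower_Taylor_quadratic[OF that] that exp_ge_zero[of "- s"]
      unfolding distrib_left by linarith
    show ?thesis using *[of t] *[of "- t"] by (cases "0 \<le> t") simp_all
  qed
  have "integrable (multivariate_normal m S) (\<lambda>y. (y $ i)\<^sup>2)" for i
  proof (rule Bochner_Integration.integrable_bound)
    show "integrable (multivariate_normal m S) (\<lambda>y. 2 * (exp (y $ i) + exp (- y $ i)))"
      using multivariate_normal_exp_component[OF assms, of m 1 i]
        multivariate_normal_exp_component[OF assms, of m "-1" i]
      by (simp add: has_bochner_integral_iff)
    show "(\<lambda>y. (y $ i)\<^sup>2) \<in> borel_measurable (multivariate_normal m S)"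
      by measurable
    show "AE y in multivariate_normal m S. norm ((y $ i)\<^sup>2) \<le> norm (2 * (exp (y $ i) + exp (- y $ i)))"
      using sq by (simp add: add_pos_pos)
  qed
  then have "integrable (multivariate_normal m S) (\<lambda>y. \<Sum>i\<in>UNIV. (y $ i)\<^sup>2)"
    by (intro Bochner_Integration.integrable_sum)
  moreover have "(norm y)\<^sup>2 = (\<Sum>i\<in>UNIV. (y $ i)\<^sup>2)" for y :: "real ^ 'd"
    by (simp add: norm_vec_def L2_set_def sum_nonneg)
  ultimately show ?thesis by simp
qed


section \<open>Couplings of finite cost\<close>

lemma coupling_marginals:
  assumes P: "P \<in> couplings M N" and M: "sets M = sets borel" and N: "sets N = sets borel"
  shows "fst \<in> P \<rightarrow>\<^sub>M borel" "snd \<in> P \<rightarrow>\<^sub>M borel" "distr P borel fst = M" "distr P borel snd = N"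
proof -
  have S: "sets P = sets (M \<Otimes>\<^sub>M N)" and D: "distr P M fst = M" "distr P N snd = N"
    using P by (auto simp: couplings_def)
  show "fst \<in> P \<rightarrow>\<^sub>M borel" "snd \<in> P \<rightarrow>\<^sub>M borel"
    using measurable_fst[of M N] measurable_snd[of M N]
    by (simp_all cong: measurable_cong_sets add: S M N)
  show "distr P borel fst = M" "distr P borel snd = N"
    using D M N by (simp_all cong: distr_cong)
qed

lemma coupling_has_bochner_integral:
  fixes f g :: "'a::euclidean_space \<Rightarrow> real"
  assumes P: "P \<in> couplings M N" and M: "sets M = sets borel" and N: "sets N = sets borel"
  shows "has_bochner_integral M f a \<Longrightarrow> has_bochner_integral P (\<lambda>p. f (fst p)) a"
    and "has_bochner_integral N g b \<Longrightarrow> has_bochner_integral P (\<lambda>p. g (snd p)) b"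
proof -
  note marg = coupling_marginals[OF assms]
  show "has_bochner_integral P (\<lambda>p. f (fst p)) a" if "has_bochner_integral M f a"
  proof -
    have "f \<in> borel_measurable borel"
      using borel_measurable_has_bochner_integral[OF that] M by (simp cong: measurable_cong_sets)
    with that marg(1) show ?thesis
      unfolding marg(3)[symmetric]
      by (simp add: has_bochner_integral_iff integrable_distr_eq integral_distr)
  qed
  show "has_bochner_integral P (\<lambda>p. g (snd p)) b" if "has_bochner_integral N g b"
  proof -
    have "g \<in> borel_measurable borel"
      using borel_measurable_has_bochner_integral[OF that] N by (simp cong: measurable_cong_sets)
    with that marg(2) show ?thesis
      unfolding marg(4)[symmetric]
      by (simp add: has_bochner_integral_iff integrable_distr_eq integral_distr)
  qed
qed

text \<open>
  An infimum of reals over the empty set is an unspecified number, so lower bounds on the infimum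
  defining \<open>wasserstein2\<close> require the existence of a coupling.
\<close>

lemma couplings_multivariate_normal_nonempty:
  fixes m1 m2 :: "real ^ 'd"
  shows "couplings (multivariate_normal m1 S1) (multivariate_normal m2 S2) \<noteq> {}"
proof -
  \<comment> \<open>Both laws are images of the same standard normal vector.\<close>
  define h where "h = (\<lambda>x. (m1 + covariance_root S1 *v x, m2 + covariance_root S2 *v x))"
  define P where "P = distr std_normal_vec
    (multivariate_normal m1 S1 \<Otimes>\<^sub>M multivariate_normal m2 S2) h"
  have h: "h \<in> std_normal_vec \<rightarrow>\<^sub>M multivariate_normal m1 S1 \<Otimes>\<^sub>M multivariate_normal m2 S2"
    unfolding h_def by measurable
  have "distr P (multivariate_normal m1 S1) fst = multivariate_normal m1 S1"
    unfolding P_def using h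
    by (subst distr_distr) (auto simp: h_def comp_def multivariate_normal_def intro!: distr_cong)
  moreover have "distr P (multivariate_normal m2 S2) snd = multivariate_normal m2 S2"
    unfolding P_def using h
    by (subst distr_distr) (auto simp: h_def comp_def multivariate_normal_def intro!: distr_cong)
  ultimately have "P \<in> couplings (multivariate_normal m1 S1) (multivariate_normal m2 S2)"
    by (simp add: couplings_def P_def)
  then show ?thesis by blast
qed

lemma coupling_multivariate_normal_finite_cost:
  assumes cov: "covariance_matrix S1" "covariance_matrix S2"
    and P: "P \<in> couplings (multivariate_normal m1 S1) (multivariate_normal m2 S2)"
  shows "integrable P (\<lambda>(x, y). (norm (x - y))\<^sup>2)"
proof -
  note marg = coupling_marginals[OF P sets_multivariate_normal sets_multivariate_normal]
  note [measurable] = marg(1,2)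
  note hbi = coupling_has_bochner_integral[OF P sets_multivariate_normal sets_multivariate_normal]
  have int: "integrable P (\<lambda>p. (norm (fst p))\<^sup>2)" "integrable P (\<lambda>p. (norm (snd p))\<^sup>2)"
    using hbi(1)[OF has_bochner_integral_integrable
        [OF integrable_norm_square_multivariate_normal[OF cov(1)]]]
      hbi(2)[OF has_bochner_integral_integrable
        [OF integrable_norm_square_multivariate_normal[OF cov(2)]]]
    by (simp_all add: has_bochner_integral_iff)
  have "(norm (x - y))\<^sup>2 \<le> 2 * (norm x)\<^sup>2 + 2 * (norm y)\<^sup>2" for x y :: "real ^ 'a"
  proof -
    have "(norm (x - y))\<^sup>2 \<le> (norm x + norm y)\<^sup>2"
      by (intro power_mono norm_triangle_ineq4) simp
    also have "\<dots> \<le> 2 * (norm x)\<^sup>2 + 2 * (norm y)\<^sup>2"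
      using sum_squares_bound[of "norm x" "norm y"] by (simp add: power2_sum)
    finally show ?thesis .
  qed
  then show ?thesis
    unfolding case_prod_beta
    by (intro Bochner_Integration.integrable_bound
        [OF Bochner_Integration.integrable_add
          [OF integrable_mult_right[OF int(1), of 2] integrable_mult_right[OF int(2), of 2]]])
      (auto intro!: AE_I2)
qed

section \<open>Comparison of the exponent functions\<close>

lemma integral_Cauchy_Schwarz:
  fixes f g :: "'a \<Rightarrow> real"
  assumes f: "integrable M (\<lambda>x. (f x)\<^sup>2)" "\<And>x. 0 \<le> f x" and g: "integrable M (\<lambda>x. (g x)\<^sup>2)" "\<And>x. 0 \<le> g x"
    and [measurable]: "f \<in> borel_measurable M" "g \<in> borel_measurable M"
  shows "integrable M (\<lambda>x. f x * g x)"
    and "(\<integral>x. f x * g x \<partial>M) \<le> sqrt (\<integral>x. (f x)\<^sup>2 \<partial>M) * sqrt (\<integral>x. (g x)\<^sup>2 \<partial>M)"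
proof -
  show int: "integrable M (\<lambda>x. f x * g x)"
  proof (rule Bochner_Integration.integrable_bound)
    show "integrable M (\<lambda>x. (f x)\<^sup>2 + (g x)\<^sup>2)" using f g by simp
    have "f x * g x \<le> (f x)\<^sup>2 + (g x)\<^sup>2" for x
      using sum_squares_bound[of "f x" "g x"] f(2)[of x] g(2)[of x]
        mult_nonneg_nonneg[OF f(2)[of x] g(2)[of x]] by linarith
    then show "AE x in M. norm (f x * g x) \<le> norm ((f x)\<^sup>2 + (g x)\<^sup>2)"
      using f(2) g(2) by simp
  qed simp
  have "(\<integral>\<^sup>+x. ennreal (f x) * ennreal (g x) \<partial>M)\<^sup>2
      \<le> (\<integral>\<^sup>+x. (ennreal (f x))\<^sup>2 \<partial>M) * (\<integral>\<^sup>+x. (ennreal (g x))\<^sup>2 \<partial>M)"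
    by (rule Cauchy_Schwarz_nn_integral) simp_all
  then have "(ennreal (\<integral>x. f x * g x \<partial>M))\<^sup>2 \<le> ennreal (\<integral>x. (f x)\<^sup>2 \<partial>M) * ennreal (\<integral>x. (g x)\<^sup>2 \<partial>M)"
    using f g int
    by (simp add: ennreal_mult[symmetric] ennreal_power nn_integral_eq_integral)
  then have "(\<integral>x. f x * g x \<partial>M)\<^sup>2 \<le> (\<integral>x. (f x)\<^sup>2 \<partial>M) * (\<integral>x. (g x)\<^sup>2 \<partial>M)"
    using f(2) g(2) by (simp add: ennreal_mult[symmetric] ennreal_power integral_nonneg)
  then show "(\<integral>x. f x * g x \<partial>M) \<le> sqrt (\<integral>x. (f x)\<^sup>2 \<partial>M) * sqrt (\<integral>x. (g x)\<^sup>2 \<partial>M)"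
    by (metis real_le_rsqrt real_sqrt_mult)
qed

lemma abs_exp_diff_le:
  "\<bar>exp u - exp v\<bar> \<le> max (exp u) (exp v) * \<bar>u - v\<bar>" for u v :: real
proof -
  have *: "exp a - exp b \<le> exp a * (a - b)" for a b :: real
    using exp_ge_add_one_self[of "b - a"] mult_left_mono[of "1 + (b - a)" "exp (b - a)" "exp a"]
    by (simp add: exp_diff algebra_simps)
  show ?thesis
    using *[of u v] *[of v u] by (cases "v \<le> u") (auto simp: max_def)
qed

lemma abs_Max_diff_le:
  fixes f g :: "'i::finite \<Rightarrow> real"
  assumes "\<And>i. \<bar>f i - g i\<bar> \<le> c"
  shows "\<bar>(MAX i. f i) - (MAX i. g i)\<bar> \<le> c"
proof -
  have *: "(MAX i. f i) \<le> (MAX i. g i) + c" if "\<And>i. f i \<le> g i + c" for f g :: "'i \<Rightarrow> real"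
  proof (rule Max.boundedI)
    fix a assume "a \<in> range f"
    then obtain i where "a = f i" by blast
    moreover have "g i \<le> (MAX i. g i)" by (rule Max_ge) simp_all
    ultimately show "a \<le> (MAX i. g i) + c" using that[of i] by linarith
  qed simp_all
  have "f i \<le> g i + c" "g i \<le> f i + c" for i
    using assms[of i] by linarith+
  then have "(MAX i. f i) \<le> (MAX i. g i) + c" "(MAX i. g i) \<le> (MAX i. f i) + c"
    by (intro *; blast)+
  then show ?thesis by (simp only: abs_le_iff) linarith
qed

text \<open>
  The integrand of the exponent function at \<open>x\<close>, as a function of the shifted exponent
  \<open>y = u - half_variances S\<close>. Its law \<open>multivariate_normal (- half_variances S) S\<close> is the one that
  enters the Wasserstein distance.
\<close>

definition br_max :: "real ^ 'd \<Rightarrow> real ^ 'd \<Rightarrow> real" where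
  "br_max x y = (MAX i. exp (y $ i) / x $ i)"

lemma borel_measurable_br_max [measurable]: "br_max x \<in> borel_measurable borel"
  unfolding br_max_def by measurable

lemma br_max_ge: "exp (y $ i) / x $ i \<le> br_max x y"
  unfolding br_max_def by (rule Max_ge) simp_all

lemma exponent_function_br_spectral:
  fixes S :: "real ^ 'd ^ 'd"
  assumes [measurable]: "U \<in> borel_measurable M"
    and U: "distr M borel U = multivariate_normal 0 S"
  shows "exponent_function M (\<lambda>w. br_spectral S (U w)) x
    = (\<integral>y. br_max x y \<partial>multivariate_normal (- half_variances S) S)"
proof -
  have "multivariate_normal (- half_variances S) S
      = distr M borel (\<lambda>w. - half_variances S + U w)"
    by (subst multivariate_normal_shift) (simp add: U[symmetric] distr_distr comp_def)
  then show ?thesis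
    by (simp add: integral_distr exponent_function_def br_max_def br_spectral_def
        half_variances_def)
qed

lemma br_normal_exp_component:
  fixes S :: "real ^ 'd ^ 'd"
  assumes "covariance_matrix S"
  defines "N \<equiv> multivariate_normal (- half_variances S) S"
  shows "has_bochner_integral N (\<lambda>y. exp (y $ i)) 1"
    and "has_bochner_integral N (\<lambda>y. exp (2 * y $ i)) (exp (S $ i $ i))"
  using multivariate_normal_exp_component[OF assms(1), of "- half_variances S" 1 i]
    multivariate_normal_exp_component[OF assms(1), of "- half_variances S" 2 i]
  by (simp_all add: N_def half_variances_def)

lemma integrable_br_max:
  fixes S :: "real ^ 'd ^ 'd"
  assumes S: "covariance_matrix S" and x: "\<And>i. 0 < x $ i"
  shows "integrable (multivariate_normal (- half_variances S) S) (br_max x)"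
proof (rule Bochner_Integration.integrable_bound)
  show "integrable (multivariate_normal (- half_variances S) S) (\<lambda>y. \<Sum>i\<in>UNIV. exp (y $ i) / x $ i)"
    using br_normal_exp_component(1)[OF S] by (simp add: has_bochner_integral_iff)
  have "norm (br_max x y) \<le> norm (\<Sum>i\<in>UNIV. exp (y $ i) / x $ i)" for y
  proof -
    have pos: "0 \<le> exp (y $ i) / x $ i" for i
      using x[of i] by simp
    have "br_max x y \<le> (\<Sum>i\<in>UNIV. exp (y $ i) / x $ i)"
      unfolding br_max_def by (rule Max.boundedI) (auto intro!: member_le_sum pos)
    moreover have "0 \<le> br_max x y"
      using pos br_max_ge order_trans by blast
    ultimately show ?thesis by simp
  qed
  then show "AE y in multivariate_normal (- half_variances S) S.
      norm (br_max x y) \<le> norm (\<Sum>i\<in>UNIV. exp (y $ i) / x $ i)"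
    by simp
qed measurable

lemma inverse_le_integral_br_max:
  fixes S :: "real ^ 'd ^ 'd"
  assumes S: "covariance_matrix S" and x: "\<And>i. 0 < x $ i"
  shows "1 / x $ i \<le> (\<integral>y. br_max x y \<partial>multivariate_normal (- half_variances S) S)"
proof -
  note mean = br_normal_exp_component(1)[OF S, of i]
  have "1 / x $ i = (\<integral>y. exp (y $ i) / x $ i \<partial>multivariate_normal (- half_variances S) S)"
    using mean by (simp add: has_bochner_integral_iff)
  also have "\<dots> \<le> (\<integral>y. br_max x y \<partial>multivariate_normal (- half_variances S) S)"
    using mean integrable_br_max[OF assms]
    by (intro integral_mono br_max_ge) (simp_all add: has_bochner_integral_iff)
  finally show ?thesis .
qed

lemma abs_br_max_diff_le:
  fixes x u v :: "real ^ 'd"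
  assumes x: "\<And>i. 0 < x $ i" and m: "\<And>i. 1 / x $ i \<le> m"
  shows "\<bar>br_max x u - br_max x v\<bar>
    \<le> m * (norm (\<chi> i. max (exp (u $ i)) (exp (v $ i))) * norm (u - v))"
  unfolding br_max_def
proof (rule abs_Max_diff_le)
  fix i
  let ?h = "\<chi> i. max (exp (u $ i)) (exp (v $ i))"
  have "max (exp (u $ i)) (exp (v $ i)) * \<bar>u $ i - v $ i\<bar> \<le> norm ?h * norm (u - v)"
    using component_le_norm_cart[of ?h i] component_le_norm_cart[of "u - v" i]
    by (intro mult_mono) (auto simp: max_def split: if_splits)
  then have "\<bar>exp (u $ i) - exp (v $ i)\<bar> \<le> norm ?h * norm (u - v)"
    using abs_exp_diff_le[of "u $ i" "v $ i"] by linarith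
  then have "(1 / x $ i) * \<bar>exp (u $ i) - exp (v $ i)\<bar> \<le> m * (norm ?h * norm (u - v))"
    using m[of i] x[of i] order_trans[of 0 "1 / x $ i" m] by (intro mult_mono) simp_all
  moreover have "\<bar>exp (u $ i) / x $ i - exp (v $ i) / x $ i\<bar>
      = (1 / x $ i) * \<bar>exp (u $ i) - exp (v $ i)\<bar>"
    using x[of i] by (simp add: diff_divide_distrib[symmetric])
  ultimately show "\<bar>exp (u $ i) / x $ i - exp (v $ i) / x $ i\<bar> \<le> m * (norm ?h * norm (u - v))"
    by simp
qed

lemma integral_br_max_diff_le_coupling:
  fixes S1 S2 :: "real ^ 'd ^ 'd"
  assumes S1: "covariance_matrix S1" and S2: "covariance_matrix S2"
    and x: "\<And>i. 0 < x $ i" and m: "\<And>i. 1 / x $ i \<le> m"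
  defines "N1 \<equiv> multivariate_normal (- half_variances S1) S1"
    and "N2 \<equiv> multivariate_normal (- half_variances S2) S2"
  assumes P: "P \<in> couplings N1 N2"
  shows "\<bar>(\<integral>y. br_max x y \<partial>N1) - (\<integral>y. br_max x y \<partial>N2)\<bar>
    \<le> m * (br_const S1 S2 * sqrt (\<integral>(u, v). (norm (u - v))\<^sup>2 \<partial>P))"
proof -
  have sets: "sets N1 = sets borel" "sets N2 = sets borel"
    by (simp_all add: N1_def N2_def)
  note marg = coupling_marginals[OF P sets]
  note [measurable] = marg(1,2)
  note hbi = coupling_has_bochner_integral[OF P sets]
  define H where "H p = (\<chi> i. max (exp (fst p $ i)) (exp (snd p $ i)))" for p :: "(real ^ 'd) \<times> (real ^ 'd)"
  define D where "D p = fst p - snd p" for p :: "(real ^ 'd) \<times> (real ^ 'd)"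
  have m0: "0 \<le> m"
    using m[of undefined] x[of undefined] order_trans[of 0 "1 / x $ undefined" m] by simp
  have normH: "(norm (H p))\<^sup>2 = (\<Sum>i\<in>UNIV. (max (exp (fst p $ i)) (exp (snd p $ i)))\<^sup>2)" for p
    by (simp add: norm_vec_def L2_set_def sum_nonneg H_def)
  have [measurable]: "(\<lambda>p. fst p $ i) \<in> borel_measurable P" "(\<lambda>p. snd p $ i) \<in> borel_measurable P" for i
    using measurable_compose[OF marg(1), of "\<lambda>y. y $ i" borel]
      measurable_compose[OF marg(2), of "\<lambda>y. y $ i" borel] by simp_all
  have H_meas: "(\<lambda>p. norm (H p)) \<in> borel_measurable P"
  proof -
    have "norm (H p) = sqrt (\<Sum>i\<in>UNIV. (max (exp (fst p $ i)) (exp (snd p $ i)))\<^sup>2)" for p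
      by (simp add: normH[symmetric])
    then show ?thesis by (simp only:) measurable
  qed
  have D_meas: "(\<lambda>p. norm (D p)) \<in> borel_measurable P"
    unfolding D_def by measurable
  let ?b = "\<lambda>p :: (real ^ 'd) \<times> (real ^ 'd). \<Sum>i\<in>UNIV. exp (2 * fst p $ i) + exp (2 * snd p $ i)"
  have b: "has_bochner_integral P ?b (\<Sum>i\<in>UNIV. exp (S1 $ i $ i) + exp (S2 $ i $ i))"
    using br_normal_exp_component(2)[OF S1, folded N1_def] br_normal_exp_component(2)[OF S2, folded N2_def]
    by (intro has_bochner_integral_sum has_bochner_integral_add hbi)
  have Hb: "(norm (H p))\<^sup>2 \<le> ?b p" for p
    unfolding normH
  proof (rule sum_mono)
    fix i
    show "(max (exp (fst p $ i)) (exp (snd p $ i)))\<^sup>2 \<le> exp (2 * fst p $ i) + exp (2 * snd p $ i)"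
      by (simp add: max_def exp_double)
  qed
  have H_int: "integrable P (\<lambda>p. (norm (H p))\<^sup>2)"
  proof (rule Bochner_Integration.integrable_bound)
    show "integrable P ?b" using b by (simp add: has_bochner_integral_iff)
    show "(\<lambda>p. (norm (H p))\<^sup>2) \<in> borel_measurable P" using H_meas by simp
    show "AE p in P. norm ((norm (H p))\<^sup>2) \<le> norm (?b p)"
      using Hb by (intro AE_I2) (simp add: order_trans[OF Hb abs_ge_self])
  qed
  have "(\<integral>p. (norm (H p))\<^sup>2 \<partial>P) \<le> (\<integral>p. ?b p \<partial>P)"
    using b Hb H_int by (intro integral_mono) (simp_all add: has_bochner_integral_iff)
  also have "\<dots> = (\<Sum>i\<in>UNIV. exp (S1 $ i $ i) + exp (S2 $ i $ i))"
    using b by (simp only: has_bochner_integral_iff)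
  also have "\<dots> \<le> (\<Sum>i\<in>UNIV. (exp (S1 $ i $ i / 2) + exp (S2 $ i $ i / 2))\<^sup>2)"
    by (intro sum_mono) (simp add: power2_sum exp_double[symmetric])
  finally have L: "sqrt (\<integral>p. (norm (H p))\<^sup>2 \<partial>P) \<le> br_const S1 S2"
    by (simp add: br_const_def)
  have D_int: "integrable P (\<lambda>p. (norm (D p))\<^sup>2)"
    using coupling_multivariate_normal_finite_cost[OF S1 S2 P[unfolded N1_def N2_def]]
    by (simp add: D_def case_prod_unfold)
  note CS = integral_Cauchy_Schwarz[OF H_int norm_ge_zero D_int norm_ge_zero H_meas D_meas]
  have V: "has_bochner_integral P (\<lambda>p. br_max x (fst p)) (\<integral>y. br_max x y \<partial>N1)"
      "has_bochner_integral P (\<lambda>p. br_max x (snd p)) (\<integral>y. br_max x y \<partial>N2)"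
    using integrable_br_max[OF S1 x, folded N1_def] integrable_br_max[OF S2 x, folded N2_def]
    by (auto intro!: hbi has_bochner_integral_integrable)
  then have "\<bar>(\<integral>y. br_max x y \<partial>N1) - (\<integral>y. br_max x y \<partial>N2)\<bar>
      = \<bar>\<integral>p. br_max x (fst p) - br_max x (snd p) \<partial>P\<bar>"
    by (simp add: has_bochner_integral_iff)
  also have "\<dots> \<le> (\<integral>p. \<bar>br_max x (fst p) - br_max x (snd p)\<bar> \<partial>P)"
    by (rule integral_abs_bound)
  also have "\<dots> \<le> (\<integral>p. m * (norm (H p) * norm (D p)) \<partial>P)"
    using V CS(1) abs_br_max_diff_le[OF x m]
    by (intro integral_mono) (simp_all add: has_bochner_integral_iff H_def D_def)
  also have "\<dots> = m * (\<integral>p. norm (H p) * norm (D p) \<partial>P)"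
    by simp
  also have "\<dots> \<le> m * (sqrt (\<integral>p. (norm (H p))\<^sup>2 \<partial>P) * sqrt (\<integral>p. (norm (D p))\<^sup>2 \<partial>P))"
    by (intro mult_left_mono CS(2) m0)
  also have "\<dots> \<le> m * (br_const S1 S2 * sqrt (\<integral>p. (norm (D p))\<^sup>2 \<partial>P))"
    by (intro mult_left_mono mult_right_mono L m0) (simp add: integral_nonneg)
  finally show ?thesis by (simp add: D_def case_prod_unfold)
qed

lemma br_const_pos: "0 < br_const S1 S2"
  unfolding br_const_def real_sqrt_gt_0_iff
  by (intro sum_pos zero_less_power add_pos_pos) simp_all

lemma wasserstein2_multivariate_normal_greatest:
  assumes "covariance_matrix S1" "covariance_matrix S2"
    and "\<And>P. P \<in> couplings (multivariate_normal m1 S1) (multivariate_normal m2 S2) \<Longrightarrow>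
      c \<le> sqrt (\<integral>(u, v). (norm (u - v))\<^sup>2 \<partial>P)"
  shows "c \<le> wasserstein2 (multivariate_normal m1 S1) (multivariate_normal m2 S2)"
  unfolding wasserstein2_def
  using couplings_multivariate_normal_nonempty[of m1 S1 m2 S2]
    coupling_multivariate_normal_finite_cost[OF assms(1,2), of _ m1 m2]
  by (intro cINF_greatest assms(3)) auto

lemma wasserstein2_multivariate_normal_nonneg:
  assumes "covariance_matrix S1" "covariance_matrix S2"
  shows "0 \<le> wasserstein2 (multivariate_normal m1 S1) (multivariate_normal m2 S2)"
  by (intro wasserstein2_multivariate_normal_greatest assms)
    (simp add: case_prod_beta integral_nonneg)

lemma integral_br_max_diff_le_wasserstein2:
  fixes S1 S2 :: "real ^ 'd ^ 'd"
  assumes S: "covariance_matrix S1" "covariance_matrix S2"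
    and x: "\<And>i. 0 < x $ i" and m: "\<And>i. 1 / x $ i \<le> m"
  defines "N1 \<equiv> multivariate_normal (- half_variances S1) S1"
    and "N2 \<equiv> multivariate_normal (- half_variances S2) S2"
  shows "\<bar>(\<integral>y. br_max x y \<partial>N1) - (\<integral>y. br_max x y \<partial>N2)\<bar>
    \<le> br_const S1 S2 * wasserstein2 N1 N2 * m"
proof -
  let ?d = "\<bar>(\<integral>y. br_max x y \<partial>N1) - (\<integral>y. br_max x y \<partial>N2)\<bar>"
  have "0 < 1 / x $ undefined" using x[of undefined] by simp
  then have "0 < m" using m[of undefined] by linarith
  then have pos: "0 < m * br_const S1 S2" by (intro mult_pos_pos br_const_pos)
  have "?d / (m * br_const S1 S2) \<le> wasserstein2 N1 N2"
    unfolding N1_def N2_def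
  proof (rule wasserstein2_multivariate_normal_greatest[OF S], fold N1_def N2_def)
    fix P assume "P \<in> couplings N1 N2"
    then have "?d \<le> m * (br_const S1 S2 * sqrt (\<integral>(u, v). (norm (u - v))\<^sup>2 \<partial>P))"
      unfolding N1_def N2_def by (rule integral_br_max_diff_le_coupling[OF S x m])
    then show "?d / (m * br_const S1 S2) \<le> sqrt (\<integral>(u, v). (norm (u - v))\<^sup>2 \<partial>P)"
      using pos by (simp add: pos_divide_le_eq mult_ac)
  qed
  then show ?thesis
    using pos by (simp add: pos_divide_le_eq mult_ac)
qed

section \<open>The function \<open>omega\<close>\<close>

lemma exp_diff_le_omega:
  assumes t: "0 \<le> t" and ab: "b \<le> (1 + t) * a"
  shows "exp (- a) - exp (- b) \<le> omega t"
proof (cases "t = 0")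
  case True
  then show ?thesis using ab by (simp add: omega_def)
next
  case False
  with t have t: "0 < t" by simp
  \<comment> \<open>\<open>exp (- a) - exp (- (1 + t) * a)\<close> is maximal at \<open>a = c\<close>.\<close>
  define c where "c = ln (1 + t) / t"
  define s where "s = a - c"
  have tc: "exp (- (t * c)) = 1 / (1 + t)"
    using t by (simp add: c_def exp_minus inverse_eq_divide)
  have "1 + t \<le> exp (- (t * s)) + t * exp s"
    using exp_ge_add_one_self[of "- (t * s)"]
      mult_left_mono[OF exp_ge_add_one_self[of s], of t] t by (simp add: algebra_simps)
  then have "exp (- s) * (1 + t) \<le> exp (- s) * (exp (- (t * s)) + t * exp s)"
    by (intro mult_left_mono) simp_all
  also have "\<dots> = exp (- s) * exp (- (t * s)) + t"
    by (simp add: distrib_left exp_minus)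
  finally have "(exp (- s) * (1 + t) - exp (- s) * exp (- (t * s))) / (1 + t) \<le> t / (1 + t)"
    using t by (intro divide_right_mono) simp_all
  then have "exp (- s) - exp (- s) * exp (- (t * s)) / (1 + t) \<le> t / (1 + t)"
    using t by (simp add: diff_divide_distrib)
  then have "exp (- c) * (exp (- s) - exp (- s) * exp (- (t * s)) * exp (- (t * c)))
      \<le> exp (- c) * (t / (1 + t))"
    unfolding tc by (intro mult_left_mono) simp_all
  moreover have "exp (- c) * (exp (- s) - exp (- s) * exp (- (t * s)) * exp (- (t * c)))
      = exp (- a) - exp (- ((1 + t) * a))"
    by (simp add: right_diff_distrib exp_add[symmetric] s_def algebra_simps)
  moreover have "exp (- ((1 + t) * a)) \<le> exp (- b)" using ab by simp
  moreover have "exp (- c) * (t / (1 + t)) = omega t"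
    using t by (simp add: omega_def c_def powr_def)
  ultimately show ?thesis by linarith
qed

lemma omega_nonneg: "0 \<le> t \<Longrightarrow> 0 \<le> omega t"
  by (simp add: omega_def)

lemma omega_le_divide_e:
  assumes "0 \<le> t"
  shows "omega t \<le> t / exp 1"
proof (cases "t = 0")
  case False
  with assms have t: "0 < t" by simp
  have "ln (1 / (1 + t)) \<le> 1 / (1 + t) - 1"
    using t by (intro ln_le_minus_one) simp
  then have "t / (1 + t) \<le> ln (1 + t)"
    using t by (simp add: ln_div field_simps)
  then have "1 \<le> ln (1 + t) / t + ln (1 + t)"
    using t by (simp add: field_simps)
  then have "exp (- (ln (1 + t) / t) - ln (1 + t)) \<le> exp (- 1)"
    by simp
  then have "(1 + t) powr (- 1 / t) / (1 + t) \<le> 1 / exp 1"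
    using t by (simp add: powr_def exp_diff exp_minus inverse_eq_divide)
  from mult_left_mono[OF this, of t] t show ?thesis
    by (simp add: omega_def)
qed (simp add: omega_def)

theorem mainTheorem10:
  fixes S1 S2 :: "real ^ 'd ^ 'd"
    and M1 :: "'w1 measure" and M2 :: "'w2 measure"
    and U1 Z1 :: "'w1 \<Rightarrow> real ^ 'd" and U2 Z2 :: "'w2 \<Rightarrow> real ^ 'd"
    and F1 F2 :: "real ^ 'd \<Rightarrow> real"
  assumes "covariance_matrix S1" and "covariance_matrix S2"
    and "prob_space M1" and "prob_space M2"
    and "U1 \<in> borel_measurable M1" and "U2 \<in> borel_measurable M2"
    and "distr M1 borel U1 = multivariate_normal 0 S1"
    and "distr M2 borel U2 = multivariate_normal 0 S2"
    and "Z1 = (\<lambda>w. br_spectral S1 (U1 w))" and "Z2 = (\<lambda>w. br_spectral S2 (U2 w))"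
    and "F1 = max_stable_cdf (exponent_function M1 Z1)"
    and "F2 = max_stable_cdf (exponent_function M2 Z2)"
  shows "kolmogorov_dist F1 F2 \<le>
      omega (br_const S1 S2 *
        wasserstein2 (multivariate_normal (- half_variances S1) S1)
                     (multivariate_normal (- half_variances S2) S2))
    \<and> kolmogorov_dist F1 F2 \<le>
      br_const S1 S2 / exp 1 *
        wasserstein2 (multivariate_normal (- half_variances S1) S1)
                     (multivariate_normal (- half_variances S2) S2)"
proof -
  define N1 N2 where "N1 = multivariate_normal (- half_variances S1) S1"
    and "N2 = multivariate_normal (- half_variances S2) S2"
  define t where "t = br_const S1 S2 * wasserstein2 N1 N2"
  note S = assms(1,2)
  have t: "0 \<le> t"
    using wasserstein2_multivariate_normal_nonneg[OF S] br_const_pos[of S1 S2]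
    by (simp add: t_def N1_def N2_def)
  have F: "F1 = max_stable_cdf (\<lambda>x. \<integral>y. br_max x y \<partial>N1)"
      "F2 = max_stable_cdf (\<lambda>x. \<integral>y. br_max x y \<partial>N2)"
    using exponent_function_br_spectral[OF assms(5,7)] exponent_function_br_spectral[OF assms(6,8)]
    by (simp_all add: assms(9-12) N1_def N2_def max_stable_cdf_def fun_eq_iff)
  have "\<bar>F1 x - F2 x\<bar> \<le> omega t" for x
  proof (cases "\<forall>i. 0 < x $ i")
    case True
    then have x: "\<And>i. 0 < x $ i" by blast
    define V1 V2 m where "V1 = (\<integral>y. br_max x y \<partial>N1)" and "V2 = (\<integral>y. br_max x y \<partial>N2)"
      and "m = (MAX i. 1 / x $ i)"
    have m: "1 / x $ i \<le> m" for i
      unfolding m_def by (rule Max_ge) simp_all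
    have "m \<le> V1" "m \<le> V2"
      unfolding m_def V1_def V2_def N1_def N2_def
      using inverse_le_integral_br_max[OF S(1) x] inverse_le_integral_br_max[OF S(2) x]
      by (auto intro!: Max.boundedI)
    moreover have "\<bar>V1 - V2\<bar> \<le> t * m"
      unfolding V1_def V2_def t_def N1_def N2_def
      by (rule integral_br_max_diff_le_wasserstein2[OF S x m])
    ultimately have "V2 \<le> (1 + t) * V1" "V1 \<le> (1 + t) * V2"
      using mult_left_mono[OF _ t, of m V1] mult_left_mono[OF _ t, of m V2]
      by (simp_all add: distrib_right)
    from exp_diff_le_omega[OF t this(1)] exp_diff_le_omega[OF t this(2)]
    show ?thesis
      using True by (simp add: F max_stable_cdf_def V1_def V2_def)
  next
    case False
    then show ?thesis
      unfolding F max_stable_cdf_def if_not_P[OF False] using omega_nonneg[OF t] by simp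
  qed
  then have "kolmogorov_dist F1 F2 \<le> omega t"
    unfolding kolmogorov_dist_def by (intro cSUP_least) simp_all
  with omega_le_divide_e[OF t] show ?thesis
    by (simp add: t_def N1_def N2_def)
qed

end
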